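(* Let $(R,\mathfrak{m})$ be a local commutative ring (with identity) such that $\bigcap_{\ell\ge 1}\mathfrak{m}^{\ell}=\{0\}$. Then the following are equivalent: (1) $R$ is a chain ring; (2) for all finitely generated $R$-modules $V,V'$ with $V'$ an $R$-submodule of $V$, one has $\mu_R(V')\le \mu_R(V)$; (3) for all finitely generated ideals $\mathfrak{a},\mathfrak{a}'$ of $R$ with $\mathfrak{a}'\subseteq\mathfrak{a}$, one has $\mu_R(\mathfrak{a}')\le\mu_R(\mathfrak{a})$.
   Context: A commutative ring $R$ is a chain ring if its ideals are linearly (totally) ordered by inclusion. For a local commutative ring $(R,\mathfrak{m})$ and a finitely generated $R$-module $V$, $\mu_R(V):=\dim_{R/\mathfrak{m}}(V/\mathfrak{m}V)$, which equals the minimal number of generators of $V$. No finiteness assumption on $R$ is made. *)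

theory Defs
  imports
    "HOL-Algebra.QuotRing"
    "HOL-Algebra.Ideal_Product"
    "Jordan_Normal_Form.Missing_VectorSpace"
begin

definition chain_ring :: "('a, 'r) ring_scheme \<Rightarrow> bool" where
  "chain_ring R \<longleftrightarrow>
     cring R \<and> (\<forall>I J. ideal I R \<longrightarrow> ideal J R \<longrightarrow> I \<subseteq> J \<or> J \<subseteq> I)"

locale local_ring = cring R + maximalideal \<mm> R for R (structure) and \<mm> +
  assumes maximal_unique: "maximalideal J R \<Longrightarrow> J = \<mm>"

definition fg_module ::
    "('a, 'r) ring_scheme \<Rightarrow> ('a, 'b, 's) module_scheme \<Rightarrow> bool" where
  "fg_module R V \<longleftrightarrow>
     module R V \<and> (\<exists>S. finite S \<and> S \<subseteq> carrier V \<and> module.span R V S = carrier V)"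

definition fg_ideal :: "('a, 'r) ring_scheme \<Rightarrow> 'a set \<Rightarrow> bool" where
  "fg_ideal R I \<longleftrightarrow> (\<exists>S. finite S \<and> S \<subseteq> carrier R \<and> I = genideal R S)"

text \<open>The record fields \<open>mult\<close> and \<open>one\<close> are irrelevant for a module.\<close>

definition ideal_module :: "('a, 'r) ring_scheme \<Rightarrow> 'a set \<Rightarrow> ('a, 'a) module" where
  "ideal_module R I =
     \<lparr>carrier = I, mult = mult R, one = one R, zero = zero R, add = add R, smult = mult R\<rparr>"

definition ideal_smult ::
    "('a, 'r) ring_scheme \<Rightarrow> 'a set \<Rightarrow> ('a, 'b, 's) module_scheme \<Rightarrow> 'b set" where
  "ideal_smult R I V =
     module.span R V {a \<odot>\<^bsub>V\<^esub> x | a x. a \<in> I \<and> x \<in> carrier V}"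

text \<open>
  \<open>V / I V\<close> as a module over \<open>R Quot I\<close>. The scalar multiplication is
  \<open>(a + I) (x + I V) = a x + I V\<close>, written as a union over representatives in the
  same way as \<open>rcoset_mult\<close> in the definition of \<open>FactRing\<close>.
\<close>

definition reduced_module ::
    "('a, 'r) ring_scheme \<Rightarrow> 'a set \<Rightarrow> ('a, 'b, 's) module_scheme \<Rightarrow> ('a set, 'b set) module" where
  "reduced_module R I V =
     (let N = ideal_smult R I V in
       \<lparr>carrier = a_rcosets\<^bsub>V\<^esub> N,
        mult = (\<lambda>_ _. N), one = N,
        zero = N, add = set_add V,
        smult = (\<lambda>A X. \<Union>a\<in>A. \<Union>x\<in>X. N +>\<^bsub>V\<^esub> (a \<odot>\<^bsub>V\<^esub> x))\<rparr>)"

definition mu ::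
    "('a, 'r) ring_scheme \<Rightarrow> 'a set \<Rightarrow> ('a, 'b, 's) module_scheme \<Rightarrow> nat" where
  "mu R \<mm> V = vectorspace.dim (R Quot \<mm>) (reduced_module R \<mm> V)"

text \<open>The type argument is the universe from which the modules \<open>V\<close> are taken.\<close>

definition mu_mono_modules ::
    "'b itself \<Rightarrow> ('a, 'r) ring_scheme \<Rightarrow> 'a set \<Rightarrow> bool" where
  "mu_mono_modules (_ :: 'b itself) R \<mm> \<longleftrightarrow>
     (\<forall>(V :: ('a, 'b) module) V'.
        fg_module R V \<longrightarrow> submodule R V' V \<longrightarrow> fg_module R (V\<lparr>carrier := V'\<rparr>) \<longrightarrow>
        mu R \<mm> (V\<lparr>carrier := V'\<rparr>) \<le> mu R \<mm> V)"

definition mu_mono_ideals :: "('a, 'r) ring_scheme \<Rightarrow> 'a set \<Rightarrow> bool" where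
  "mu_mono_ideals R \<mm> \<longleftrightarrow>
     (\<forall>\<aa> \<aa>'. fg_ideal R \<aa> \<longrightarrow> fg_ideal R \<aa>' \<longrightarrow> \<aa>' \<subseteq> \<aa> \<longrightarrow>
        mu R \<mm> (ideal_module R \<aa>') \<le> mu R \<mm> (ideal_module R \<aa>))"

text \<open>
  Every finitely generated \<open>R\<close>-module is isomorphic to a quotient of some \<open>R\<^sup>n\<close>, so up to
  isomorphism it has a carrier consisting of sets of functions \<open>nat \<Rightarrow> 'a\<close>: this type is a
  universe for all finitely generated modules.
\<close>

type_synonym 'a fg_universe = "(nat \<Rightarrow> 'a) set"

end

theory Submission
  imports "HOL-Algebra.Ring_Divisibility" Defs
begin

text \<open>By Nakayama's lemma, \<open>\<mu>(V) \<le> n\<close> holds iff the finitely generated module \<open>V\<close> is generated by at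
  most \<open>n\<close> elements. Over a chain ring, Gaussian elimination shows that every finitely generated
  submodule of a module with \<open>n\<close> generators has at most \<open>n\<close> generators. Conversely, if \<open>\<mu>\<close> is
  monotone on ideals, then comparing \<open>(a, b)\<close> with \<open>R = (1)\<close> shows that \<open>(a, b)\<close> is principal, and in
  a local ring this forces \<open>a\<close> to divide \<open>b\<close> or \<open>b\<close> to divide \<open>a\<close>.\<close>

section \<open>Local rings\<close>

text \<open>Two obstacles shape the development. \<open>mu\<close> is the dimension of a quotient
  module over a quotient ring, which is awkward to compare directly; all comparisons therefore go
  through generator counts. The other obstacle is that modules are drawn from a fixed type. Passing
  from modules to ideals is mere instantiation on paper, but an ideal lives in \<open>'a\<close>
  while the modules of condition (2) live in \<open>'a fg_universe\<close>, so the ideal has to be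
  carried along an injection. Reduction modulo \<open>\<mm>\<close> and this transport are both
  surjective semilinear maps and share one locale.\<close>

lemma (in ring) exists_maximalideal_superset:
  assumes "ideal I R" and "\<one> \<notin> I"
  shows "\<exists>J. maximalideal J R \<and> I \<subseteq> J"
proof -
  \<comment> \<open>Properness is expressed by avoiding the single element \<open>\<one>\<close>, so
    it survives unions of chains and Zorn's lemma applies.\<close>
  define A where "A = {J. ideal J R \<and> I \<subseteq> J \<and> \<one> \<notin> J}"
  have "\<Union>C \<in> A" if "C \<noteq> {}" and C: "subset.chain A C" for C
  proof -
    have "subset.chain {J. ideal J R} C"
      using C unfolding subset.chain_def A_def by blast
    from chain_Union_is_ideal[OF this] \<open>C \<noteq> {}\<close> have "ideal (\<Union>C) R" by simp
    then show ?thesis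
      using C \<open>C \<noteq> {}\<close> unfolding subset.chain_def A_def by blast
  qed
  moreover have "A \<noteq> {}" using assms unfolding A_def by blast
  ultimately obtain J where J: "J \<in> A" and max: "\<And>K. K \<in> A \<Longrightarrow> J \<subseteq> K \<Longrightarrow> K = J"
    using subset_Zorn_nonempty[of A] by metis
  have "maximalideal J R"
  proof (rule maximalidealI)
    show "ideal J R" using J by (simp add: A_def)
    show "carrier R \<noteq> J" using J by (auto simp: A_def)
    fix K assume K: "ideal K R" "J \<subseteq> K" "K \<subseteq> carrier R"
    show "K = J \<or> K = carrier R"
    proof (cases "\<one> \<in> K")
      case True
      then show ?thesis using ideal.one_imp_carrier[OF K(1)] by simp
    next
      case False
      then show ?thesis using max[of K] J K by (auto simp: A_def)
    qed
  qed
  then show ?thesis using J by (auto simp: A_def)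
qed

context local_ring
begin

lemma one_notin_maximal: "\<one> \<notin> \<mm>"
  using I_notcarr one_imp_carrier by blast

text \<open>A nonunit generates a proper ideal, which lies in some maximal ideal, and locality
  leaves only \<open>\<mm>\<close> for it.\<close>

lemma Units_if_notin_maximal:
  assumes "a \<in> carrier R" and "a \<notin> \<mm>"
  shows "a \<in> Units R"
proof (rule ccontr)
  assume "a \<notin> Units R"
  then have "\<one> \<notin> PIdl a"
    using assms(1) by (auto simp: cgenideal_def Units_def m_comm)
  then obtain J where "maximalideal J R" "PIdl a \<subseteq> J"
    using exists_maximalideal_superset[OF cgenideal_ideal[OF assms(1)]] by blast
  then show False
    using maximal_unique[of J] cgenideal_self[OF assms(1)] assms(2) by blast
qed

text \<open>Otherwise \<open>\<mm>\<close> would contain \<open>a\<close> and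
  \<open>\<one> \<ominus> a\<close>, hence their sum \<open>\<one>\<close>. This unit is what allows
  cancellation both in Nakayama's lemma and in the divisibility argument.\<close>

lemma Units_one_minus:
  assumes "a \<in> \<mm>"
  shows "\<one> \<ominus> a \<in> Units R"
proof (rule Units_if_notin_maximal)
  have a: "a \<in> carrier R" using assms Icarr by blast
  then show "\<one> \<ominus> a \<in> carrier R" by simp
  show "\<one> \<ominus> a \<notin> \<mm>"
  proof
    assume "\<one> \<ominus> a \<in> \<mm>"
    then have "(\<one> \<ominus> a) \<oplus> a \<in> \<mm>" using assms a_closed by blast
    moreover have "(\<one> \<ominus> a) \<oplus> a = \<one>"
      using a by (simp add: minus_eq a_assoc l_neg)
    ultimately show False using one_notin_maximal by simp
  qed
qed

end

section \<open>Spans\<close>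

context module
begin

lemma submodule_a_inv:
  assumes "submodule R N M" and "x \<in> N"
  shows "\<ominus>\<^bsub>M\<^esub> x \<in> N"
proof -
  have "x \<in> carrier M" using assms submodule.subset by blast
  then have "\<ominus>\<^bsub>M\<^esub> x = (\<ominus> \<one>) \<odot>\<^bsub>M\<^esub> x" by (simp add: smult_minus_1)
  then show ?thesis using submodule.smult_closed[OF assms(1) _ assms(2), of "\<ominus> \<one>"] by simp
qed

lemma submodule_abelian_subgroup:
  assumes "submodule R N M"
  shows "abelian_subgroup N M"
proof (rule abelian_subgroupI3)
  show "abelian_group M" by (rule M.abelian_group_axioms)
  show "additive_subgroup N M"
  proof (rule additive_subgroup.intro, rule add.subgroupI)
    show "N \<subseteq> carrier M" "N \<noteq> {}"
      using submodule.subset[OF assms] submodule.zero_closed[OF assms] by auto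
  qed (simp_all add: submodule_a_inv[OF assms] submodule.m_closed[OF assms])
qed

text \<open>Splitting off one generator lets the later inductions avoid coefficient functions. The
  right-hand side is itself a submodule containing all generators.\<close>

lemma span_insert:
  assumes t: "t \<in> carrier M" and S: "S \<subseteq> carrier M"
  shows "span (insert t S) = {a \<odot>\<^bsub>M\<^esub> t \<oplus>\<^bsub>M\<^esub> y | a y. a \<in> carrier R \<and> y \<in> span S}" (is "_ = ?P")
proof
  note sub = span_is_submodule[OF S]
  have carr: "y \<in> carrier M" if "y \<in> span S" for y
    using submodule.subset[OF sub] that by blast
  have "submodule R ?P M"
  proof (rule submodule.intro)
    show "module R M" by (rule module_axioms)
    show "?P \<subseteq> carrier M" using t carr by auto
    have "\<zero>\<^bsub>M\<^esub> = \<zero> \<odot>\<^bsub>M\<^esub> t \<oplus>\<^bsub>M\<^esub> \<zero>\<^bsub>M\<^esub>" using t by simp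
    then show "\<zero>\<^bsub>M\<^esub> \<in> ?P" using submodule.zero_closed[OF sub] by blast
  next
    fix v w assume "v \<in> ?P" "w \<in> ?P"
    then obtain a y b z where v: "a \<in> carrier R" "y \<in> span S" "v = a \<odot>\<^bsub>M\<^esub> t \<oplus>\<^bsub>M\<^esub> y"
      and w: "b \<in> carrier R" "z \<in> span S" "w = b \<odot>\<^bsub>M\<^esub> t \<oplus>\<^bsub>M\<^esub> z" by blast
    have "v \<oplus>\<^bsub>M\<^esub> w = (a \<oplus> b) \<odot>\<^bsub>M\<^esub> t \<oplus>\<^bsub>M\<^esub> (y \<oplus>\<^bsub>M\<^esub> z)"
      using v w t carr by (simp add: smult_l_distr M.a_ac)
    moreover have "y \<oplus>\<^bsub>M\<^esub> z \<in> span S" using v w submodule.m_closed[OF sub] by blast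
    ultimately show "v \<oplus>\<^bsub>M\<^esub> w \<in> ?P" using v(1) w(1) by blast
  next
    fix c v assume c: "c \<in> carrier R" and "v \<in> ?P"
    then obtain a y where v: "a \<in> carrier R" "y \<in> span S" "v = a \<odot>\<^bsub>M\<^esub> t \<oplus>\<^bsub>M\<^esub> y" by blast
    have "c \<odot>\<^bsub>M\<^esub> v = (c \<otimes> a) \<odot>\<^bsub>M\<^esub> t \<oplus>\<^bsub>M\<^esub> c \<odot>\<^bsub>M\<^esub> y"
      using v t c carr by (simp add: smult_r_distr smult_assoc1)
    moreover have "c \<odot>\<^bsub>M\<^esub> y \<in> span S" using v c submodule.smult_closed[OF sub] by blast
    ultimately show "c \<odot>\<^bsub>M\<^esub> v \<in> ?P" using v(1) c by blast
  qed
  moreover have "insert t S \<subseteq> ?P"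
  proof -
    have "t = \<one> \<odot>\<^bsub>M\<^esub> t \<oplus>\<^bsub>M\<^esub> \<zero>\<^bsub>M\<^esub>" using t by simp
    then have "t \<in> ?P" using submodule.zero_closed[OF sub] by blast
    moreover have "s \<in> ?P" if "s \<in> S" for s
    proof -
      have "s = \<zero> \<odot>\<^bsub>M\<^esub> t \<oplus>\<^bsub>M\<^esub> s" using that t S by auto
      then show ?thesis using in_own_span[OF S] that by blast
    qed
    ultimately show ?thesis by blast
  qed
  ultimately show "span (insert t S) \<subseteq> ?P" by (rule span_is_subset[rotated])
  show "?P \<subseteq> span (insert t S)"
  proof
    fix x assume "x \<in> ?P"
    then obtain a y where x: "a \<in> carrier R" "y \<in> span S" "x = a \<odot>\<^bsub>M\<^esub> t \<oplus>\<^bsub>M\<^esub> y" by blast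
    have sub': "submodule R (span (insert t S)) M" using t S by (intro span_is_submodule) auto
    have "t \<in> span (insert t S)" using in_own_span[of "insert t S"] t S by blast
    moreover have "y \<in> span (insert t S)" using x span_is_monotone[of S "insert t S"] by blast
    ultimately show "x \<in> span (insert t S)"
      using x submodule.m_closed[OF sub'] submodule.smult_closed[OF sub'] by blast
  qed
qed

lemma span_insert_redundant:
  assumes "t \<in> span S" and "S \<subseteq> carrier M"
  shows "span (insert t S) = span S"
proof
  show "span (insert t S) \<subseteq> span S"
    using assms in_own_span by (intro span_is_subset span_is_submodule) auto
qed (rule span_is_monotone, blast)

lemma span_mono_in_span:
  assumes "S \<subseteq> span T" and "T \<subseteq> carrier M"
  shows "span S \<subseteq> span T"
  using assms by (intro span_is_subset span_is_submodule)

end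

section \<open>Images under semilinear maps\<close>

text \<open>\<open>N\<close> is only a record, not assumed to be a module: each module law over
  \<open>K\<close> is pulled back through the surjections \<open>f\<close> and
  \<open>\<rho>\<close>. The two instances are \<open>V\<close> onto \<open>V / \<mm> V\<close> over
  the quotient map of \<open>R\<close>, and transport along an injection with \<open>\<rho>\<close>
  the identity.\<close>

locale semilinear_image = module R M + K: cring K
  for R (structure) and M and K :: "('k, 's) ring_scheme"
    and N :: "('k, 'd, 'n) module_scheme" +
  fixes \<rho> and f
  assumes rho_hom: "\<rho> \<in> ring_hom R K"
    and rho_surj: "carrier K = \<rho> ` carrier R"
    and f_surj: "carrier N = f ` carrier M"
    and f_zero: "f \<zero>\<^bsub>M\<^esub> = \<zero>\<^bsub>N\<^esub>"
    and f_add: "\<lbrakk>x \<in> carrier M; y \<in> carrier M\<rbrakk> \<Longrightarrow> f (x \<oplus>\<^bsub>M\<^esub> y) = f x \<oplus>\<^bsub>N\<^esub> f y"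
    and f_smult: "\<lbrakk>a \<in> carrier R; x \<in> carrier M\<rbrakk> \<Longrightarrow> f (a \<odot>\<^bsub>M\<^esub> x) = \<rho> a \<odot>\<^bsub>N\<^esub> f x"
begin

lemma module_image: "module K N"
proof (rule module_criteria)
  show "cring K" by (rule K.is_cring)
  show "\<zero>\<^bsub>N\<^esub> \<in> carrier N" by (simp add: f_surj flip: f_zero)
  show "\<forall>v w. v \<in> carrier N \<and> w \<in> carrier N \<longrightarrow> v \<oplus>\<^bsub>N\<^esub> w \<in> carrier N"
    by (auto simp: f_surj simp flip: f_add)
  show "\<forall>v\<in>carrier N. \<exists>w\<in>carrier N. v \<oplus>\<^bsub>N\<^esub> w = \<zero>\<^bsub>N\<^esub>"
  proof
    fix v assume "v \<in> carrier N"
    then obtain x where x: "x \<in> carrier M" "v = f x" by (auto simp: f_surj)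
    then have "v \<oplus>\<^bsub>N\<^esub> f (\<ominus>\<^bsub>M\<^esub> x) = \<zero>\<^bsub>N\<^esub>" by (simp add: M.r_neg f_zero flip: f_add)
    then show "\<exists>w\<in>carrier N. v \<oplus>\<^bsub>N\<^esub> w = \<zero>\<^bsub>N\<^esub>" using x by (auto simp: f_surj)
  qed
  show "\<forall>c v. c \<in> carrier K \<and> v \<in> carrier N \<longrightarrow> c \<odot>\<^bsub>N\<^esub> v \<in> carrier N"
    by (auto simp: f_surj rho_surj simp flip: f_smult)
  show "\<forall>v w. v \<in> carrier N \<and> w \<in> carrier N \<longrightarrow> v \<oplus>\<^bsub>N\<^esub> w = w \<oplus>\<^bsub>N\<^esub> v"
    by (auto simp: f_surj M.a_comm simp flip: f_add)
  show "\<forall>v w x. v \<in> carrier N \<and> w \<in> carrier N \<and> x \<in> carrier N \<longrightarrow>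
      v \<oplus>\<^bsub>N\<^esub> w \<oplus>\<^bsub>N\<^esub> x = v \<oplus>\<^bsub>N\<^esub> (w \<oplus>\<^bsub>N\<^esub> x)"
    by (auto simp: f_surj M.a_assoc simp flip: f_add)
  show "\<forall>v\<in>carrier N. v \<oplus>\<^bsub>N\<^esub> \<zero>\<^bsub>N\<^esub> = v"
    by (auto simp: f_surj simp flip: f_add f_zero)
  show "\<forall>a b v. a \<in> carrier K \<and> b \<in> carrier K \<and> v \<in> carrier N \<longrightarrow>
      (a \<otimes>\<^bsub>K\<^esub> b) \<odot>\<^bsub>N\<^esub> v = a \<odot>\<^bsub>N\<^esub> (b \<odot>\<^bsub>N\<^esub> v)"
    by (auto simp: f_surj rho_surj smult_assoc1 simp flip: f_smult ring_hom_mult[OF rho_hom])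
  show "\<forall>v\<in>carrier N. \<one>\<^bsub>K\<^esub> \<odot>\<^bsub>N\<^esub> v = v"
    by (auto simp: f_surj simp flip: f_smult ring_hom_one[OF rho_hom])
  show "\<forall>a b v. a \<in> carrier K \<and> b \<in> carrier K \<and> v \<in> carrier N \<longrightarrow>
      (a \<oplus>\<^bsub>K\<^esub> b) \<odot>\<^bsub>N\<^esub> v = a \<odot>\<^bsub>N\<^esub> v \<oplus>\<^bsub>N\<^esub> b \<odot>\<^bsub>N\<^esub> v"
    by (auto simp: f_surj rho_surj smult_l_distr simp flip: f_smult f_add ring_hom_add[OF rho_hom])
  show "\<forall>a v w. a \<in> carrier K \<and> v \<in> carrier N \<and> w \<in> carrier N \<longrightarrow>
      a \<odot>\<^bsub>N\<^esub> (v \<oplus>\<^bsub>N\<^esub> w) = a \<odot>\<^bsub>N\<^esub> v \<oplus>\<^bsub>N\<^esub> a \<odot>\<^bsub>N\<^esub> w"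
    by (auto simp: f_surj rho_surj smult_r_distr simp flip: f_smult f_add)
qed

lemma submodule_image:
  assumes "submodule R P M"
  shows "submodule K (f ` P) N"
proof -
  note P = submodule.subset[OF assms]
  show ?thesis
  proof (rule submodule.intro)
    show "module K N" by (rule module_image)
    show "f ` P \<subseteq> carrier N" using P by (auto simp: f_surj)
    show "\<zero>\<^bsub>N\<^esub> \<in> f ` P" using submodule.zero_closed[OF assms] by (simp flip: f_zero)
  next
    fix v w assume "v \<in> f ` P" "w \<in> f ` P"
    then obtain x y where "x \<in> P" "y \<in> P" "v = f x" "w = f y" by blast
    then show "v \<oplus>\<^bsub>N\<^esub> w \<in> f ` P"
      using P submodule.m_closed[OF assms, of x y] f_add[of x y, symmetric] by auto
  next
    fix c v assume "c \<in> carrier K" "v \<in> f ` P"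
    then obtain a x where "a \<in> carrier R" "x \<in> P" "c = \<rho> a" "v = f x"
      by (auto simp: rho_surj)
    then show "c \<odot>\<^bsub>N\<^esub> v \<in> f ` P"
      using P submodule.smult_closed[OF assms, of a x] f_smult[of a x, symmetric] by auto
  qed
qed

lemma submodule_vimage:
  assumes "submodule K Q N"
  shows "submodule R {x \<in> carrier M. f x \<in> Q} M"
proof (rule submodule.intro)
  show "\<zero>\<^bsub>M\<^esub> \<in> {x \<in> carrier M. f x \<in> Q}"
    using submodule.zero_closed[OF assms] by (simp add: f_zero)
qed (auto simp: module_axioms f_add f_smult rho_surj
    intro: submodule.m_closed[OF assms] submodule.smult_closed[OF assms])

text \<open>Each inclusion is minimality of a span: the image of \<open>span S\<close> is a
  submodule containing the image of \<open>S\<close>, and the preimage of the span in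
  \<open>N\<close> is a submodule containing \<open>S\<close>.\<close>

lemma span_image:
  assumes S: "S \<subseteq> carrier M"
  shows "module.span K N (f ` S) = f ` span S"
proof
  interpret N: module K N by (rule module_image)
  have fS: "f ` S \<subseteq> carrier N" using S by (auto simp: f_surj)
  show "N.span (f ` S) \<subseteq> f ` span S"
    using in_own_span[OF S]
    by (intro N.span_is_subset submodule_image span_is_submodule S image_mono)
  have "span S \<subseteq> {x \<in> carrier M. f x \<in> N.span (f ` S)}"
    using N.in_own_span[OF fS] S
    by (intro span_is_subset submodule_vimage N.span_is_submodule fS) auto
  then show "f ` span S \<subseteq> N.span (f ` S)" by blast
qed

end

section \<open>Nakayama's lemma and the number of generators\<close>

text \<open>A bound on \<open>card S\<close> rather than an equality matches
  \<open>mu R \<mm> V \<le> n\<close> and tolerates maps under which generators collide.\<close>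

definition generated_by_at_most :: "('a, 'r) ring_scheme \<Rightarrow> ('a, 'b, 's) module_scheme \<Rightarrow> nat \<Rightarrow> bool"
  where "generated_by_at_most R V n \<longleftrightarrow>
    (\<exists>S. finite S \<and> card S \<le> n \<and> S \<subseteq> carrier V \<and> module.span R V S = carrier V)"

lemma generated_by_at_mostI:
  assumes "finite S" "card S \<le> n" "S \<subseteq> carrier V" "module.span R V S = carrier V"
  shows "generated_by_at_most R V n"
  using assms unfolding generated_by_at_most_def by blast

lemma generated_by_at_mostE:
  assumes "generated_by_at_most R V n"
  obtains S where "finite S" "card S \<le> n" "S \<subseteq> carrier V" "module.span R V S = carrier V"
  using assms unfolding generated_by_at_most_def by blast

locale local_ring_module = local_ring R \<mm> + module R V for R (structure) and \<mm> and V
begin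

abbreviation mV where "mV \<equiv> ideal_smult R \<mm> V"

lemma submodule_mV: "submodule R mV V"
  unfolding ideal_smult_def by (rule span_is_submodule) (auto simp: Icarr)

lemma smult_in_mV:
  assumes "a \<in> \<mm>" and "x \<in> carrier V"
  shows "a \<odot>\<^bsub>V\<^esub> x \<in> mV"
proof -
  have "{a \<odot>\<^bsub>V\<^esub> x | a x. a \<in> \<mm> \<and> x \<in> carrier V} \<subseteq> mV"
    unfolding ideal_smult_def by (rule in_own_span) (auto simp: Icarr)
  then show ?thesis using assms by blast
qed

text \<open>Only the coefficient of \<open>t\<close> has to stay in \<open>\<mm>\<close>; the other
  generators may contribute any element of \<open>span S\<close>. The set on the right is a
  submodule because \<open>\<mm>\<close> is an ideal.\<close>

lemma mV_insert:
  assumes t: "t \<in> carrier V" and S: "S \<subseteq> carrier V" and gen: "span (insert t S) = carrier V"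
  shows "mV \<subseteq> {a \<odot>\<^bsub>V\<^esub> t \<oplus>\<^bsub>V\<^esub> y | a y. a \<in> \<mm> \<and> y \<in> span S}" (is "_ \<subseteq> ?P")
proof -
  note sub = span_is_submodule[OF S]
  have carr: "y \<in> carrier V" if "y \<in> span S" for y
    using submodule.subset[OF sub] that by blast
  have "submodule R ?P V"
  proof (rule submodule.intro)
    show "module R V" by (rule module_axioms)
    show "?P \<subseteq> carrier V" using t carr by (auto simp: Icarr)
    have "\<zero>\<^bsub>V\<^esub> = \<zero> \<odot>\<^bsub>V\<^esub> t \<oplus>\<^bsub>V\<^esub> \<zero>\<^bsub>V\<^esub>" using t by simp
    then show "\<zero>\<^bsub>V\<^esub> \<in> ?P"
      using submodule.zero_closed[OF sub] additive_subgroup.zero_closed[OF is_additive_subgroup]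
      by blast
  next
    fix v w assume "v \<in> ?P" "w \<in> ?P"
    then obtain a y b z where v: "a \<in> \<mm>" "y \<in> span S" "v = a \<odot>\<^bsub>V\<^esub> t \<oplus>\<^bsub>V\<^esub> y"
      and w: "b \<in> \<mm>" "z \<in> span S" "w = b \<odot>\<^bsub>V\<^esub> t \<oplus>\<^bsub>V\<^esub> z" by blast
    have "v \<oplus>\<^bsub>V\<^esub> w = (a \<oplus> b) \<odot>\<^bsub>V\<^esub> t \<oplus>\<^bsub>V\<^esub> (y \<oplus>\<^bsub>V\<^esub> z)"
      using v w t carr by (simp add: Icarr smult_l_distr M.a_ac)
    moreover have "y \<oplus>\<^bsub>V\<^esub> z \<in> span S" using v w submodule.m_closed[OF sub] by blast
    moreover have "a \<oplus> b \<in> \<mm>"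
      using v w additive_subgroup.a_closed[OF is_additive_subgroup] by blast
    ultimately show "v \<oplus>\<^bsub>V\<^esub> w \<in> ?P" by blast
  next
    fix c v assume c: "c \<in> carrier R" and "v \<in> ?P"
    then obtain a y where v: "a \<in> \<mm>" "y \<in> span S" "v = a \<odot>\<^bsub>V\<^esub> t \<oplus>\<^bsub>V\<^esub> y" by blast
    have "c \<odot>\<^bsub>V\<^esub> v = (c \<otimes> a) \<odot>\<^bsub>V\<^esub> t \<oplus>\<^bsub>V\<^esub> c \<odot>\<^bsub>V\<^esub> y"
      using v t c carr by (simp add: Icarr smult_r_distr smult_assoc1)
    moreover have "c \<odot>\<^bsub>V\<^esub> y \<in> span S" using v c submodule.smult_closed[OF sub] by blast
    moreover have "c \<otimes> a \<in> \<mm>" using v c I_l_closed by blast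
    ultimately show "c \<odot>\<^bsub>V\<^esub> v \<in> ?P" by blast
  qed
  moreover have "{a \<odot>\<^bsub>V\<^esub> x | a x. a \<in> \<mm> \<and> x \<in> carrier V} \<subseteq> ?P"
  proof clarify
    fix a x assume a: "a \<in> \<mm>" and "x \<in> carrier V"
    then obtain b y where x: "b \<in> carrier R" "y \<in> span S" "x = b \<odot>\<^bsub>V\<^esub> t \<oplus>\<^bsub>V\<^esub> y"
      using gen span_insert[OF t S] by blast
    have "a \<odot>\<^bsub>V\<^esub> x = (a \<otimes> b) \<odot>\<^bsub>V\<^esub> t \<oplus>\<^bsub>V\<^esub> a \<odot>\<^bsub>V\<^esub> y"
      using a x t carr by (simp add: Icarr smult_r_distr smult_assoc1)
    moreover have "a \<odot>\<^bsub>V\<^esub> y \<in> span S" using a x submodule.smult_closed[OF sub] Icarr by blast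
    moreover have "a \<otimes> b \<in> \<mm>" using a x I_r_closed by blast
    ultimately show "\<exists>c z. a \<odot>\<^bsub>V\<^esub> x = c \<odot>\<^bsub>V\<^esub> t \<oplus>\<^bsub>V\<^esub> z \<and> c \<in> \<mm> \<and> z \<in> span S" by blast
  qed
  ultimately show ?thesis
    unfolding ideal_smult_def by (rule span_is_subset[rotated])
qed

text \<open>A generator \<open>t\<close> beyond those in \<open>W\<close> satisfies \<open>t = u + a t\<close> with \<open>a \<in> \<mm>\<close> and \<open>u\<close> in the span
  of the other generators; as \<open>1 - a\<close> is a unit, \<open>t\<close> is redundant.\<close>

lemma nakayama:
  assumes "finite T" and "T \<subseteq> carrier V" and W: "W \<subseteq> carrier V"
    and "span (W \<union> T) = carrier V"
    and cover: "\<And>x. x \<in> carrier V \<Longrightarrow> \<exists>w\<in>span W. \<exists>n\<in>mV. x = n \<oplus>\<^bsub>V\<^esub> w"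
  shows "span W = carrier V"
  \<comment> \<open>The covering condition speaks of \<open>W\<close> alone and stays fixed, so the
    extra generators in \<open>T\<close> can be discarded one at a time.\<close>
  using assms(1,2,4)
proof (induction T rule: finite_induct)
  case empty
  then show ?case by simp
next
  case (insert t T)
  define S where "S = W \<union> T"
  have S: "S \<subseteq> carrier V" and t: "t \<in> carrier V" using insert.prems W by (auto simp: S_def)
  have gen: "span (insert t S) = carrier V" using insert.prems by (simp add: S_def)
  note sub = span_is_submodule[OF S]
  obtain w n where wn: "w \<in> span W" "n \<in> mV" "t = n \<oplus>\<^bsub>V\<^esub> w" using cover[OF t] by blast
  obtain a y where ay: "a \<in> \<mm>" "y \<in> span S" "n = a \<odot>\<^bsub>V\<^esub> t \<oplus>\<^bsub>V\<^esub> y"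
    using mV_insert[OF t S gen] wn(2) by blast
  have a: "a \<in> carrier R" using ay Icarr by blast
  define u where "u = y \<oplus>\<^bsub>V\<^esub> w"
  have "w \<in> span S" using wn(1) span_is_monotone[of W S] by (auto simp: S_def)
  then have u: "u \<in> span S" using ay submodule.m_closed[OF sub] by (auto simp: u_def)
  have carr: "y \<in> carrier V" "w \<in> carrier V" "u \<in> carrier V"
    using ay(2) \<open>w \<in> span S\<close> u submodule.subset[OF sub] by auto
  define q where "q = a \<odot>\<^bsub>V\<^esub> t"
  have q: "q \<in> carrier V" using a t by (simp add: q_def)
  have "n \<oplus>\<^bsub>V\<^esub> w = q \<oplus>\<^bsub>V\<^esub> u"
    using carr q by (simp add: ay(3) u_def M.a_assoc flip: q_def)
  then have t_eq: "t = q \<oplus>\<^bsub>V\<^esub> u" by (simp only: wn(3)[symmetric])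
  have "(\<one> \<ominus> a) \<odot>\<^bsub>V\<^esub> t = t \<oplus>\<^bsub>V\<^esub> \<ominus>\<^bsub>V\<^esub> q"
    using a t by (simp add: a_minus_def smult_l_distr smult_l_minus q_def)
  also have "\<dots> = (u \<oplus>\<^bsub>V\<^esub> q) \<oplus>\<^bsub>V\<^esub> \<ominus>\<^bsub>V\<^esub> q"
    using q carr by (simp only: t_eq M.a_comm)
  also have "\<dots> = u"
    using q carr by (simp add: M.a_assoc M.r_neg)
  finally have u_eq: "(\<one> \<ominus> a) \<odot>\<^bsub>V\<^esub> t = u" .
  have unit: "\<one> \<ominus> a \<in> Units R" using ay(1) by (rule Units_one_minus)
  have "t = (inv (\<one> \<ominus> a) \<otimes> (\<one> \<ominus> a)) \<odot>\<^bsub>V\<^esub> t" using unit t by (simp add: Units_l_inv)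
  also have "\<dots> = inv (\<one> \<ominus> a) \<odot>\<^bsub>V\<^esub> u"
    using unit t a by (simp add: smult_assoc1 u_eq del: Units_l_inv)
  finally have "t \<in> span S" using u unit submodule.smult_closed[OF sub] by (metis Units_inv_closed)
  then have "span S = carrier V" using span_insert_redundant[OF _ S] gen by simp
  then show ?case using insert.IH insert.prems by (simp add: S_def)
qed

section \<open>Reduction modulo the maximal ideal\<close>

abbreviation \<pi> where "\<pi> x \<equiv> mV +>\<^bsub>V\<^esub> x"

lemma carrier_reduced_module: "carrier (reduced_module R \<mm> V) = \<pi> ` carrier V"
  by (auto simp: reduced_module_def Let_def A_RCOSETS_def')

text \<open>The product is a union over all pairs of representatives. For \<open>b = c + a\<close>
  and \<open>y = n + x\<close> one has \<open>b y = (c y + a n) + a x\<close> with the bracket in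
  \<open>mV\<close>, so all pairs give the same coset; over nonempty index sets the union is that
  coset.\<close>

lemma smult_reduced_module:
  assumes a: "a \<in> carrier R" and x: "x \<in> carrier V"
  shows "(\<mm> +> a) \<odot>\<^bsub>reduced_module R \<mm> V\<^esub> \<pi> x = \<pi> (a \<odot>\<^bsub>V\<^esub> x)"
proof -
  interpret mV: abelian_subgroup mV V
    by (rule submodule_abelian_subgroup[OF submodule_mV])
  have indep: "\<pi> (b \<odot>\<^bsub>V\<^esub> y) = \<pi> (a \<odot>\<^bsub>V\<^esub> x)" if b: "b \<in> \<mm> +> a" and y: "y \<in> \<pi> x" for b y
  proof -
    obtain c where c: "c \<in> \<mm>" "b = c \<oplus> a" using b by (auto simp: a_r_coset_def')
    obtain n where n: "n \<in> mV" "y = n \<oplus>\<^bsub>V\<^esub> x" using y by (auto simp: a_r_coset_def')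
    have cR: "c \<in> carrier R" and nV: "n \<in> carrier V"
      using c n Icarr submodule.subset[OF submodule_mV] by auto
    have yV: "y \<in> carrier V" and ay: "a \<odot>\<^bsub>V\<^esub> y = a \<odot>\<^bsub>V\<^esub> n \<oplus>\<^bsub>V\<^esub> a \<odot>\<^bsub>V\<^esub> x"
      using n nV a x by (simp_all add: smult_r_distr)
    have "b \<odot>\<^bsub>V\<^esub> y = (c \<odot>\<^bsub>V\<^esub> y \<oplus>\<^bsub>V\<^esub> a \<odot>\<^bsub>V\<^esub> n) \<oplus>\<^bsub>V\<^esub> a \<odot>\<^bsub>V\<^esub> x"
      using c(2) cR nV a x yV by (simp add: smult_l_distr ay M.a_assoc)
    moreover have "c \<odot>\<^bsub>V\<^esub> y \<oplus>\<^bsub>V\<^esub> a \<odot>\<^bsub>V\<^esub> n \<in> mV"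
      using c n nV x a submodule.m_closed[OF submodule_mV] submodule.smult_closed[OF submodule_mV]
        smult_in_mV by simp
    ultimately have "b \<odot>\<^bsub>V\<^esub> y \<in> \<pi> (a \<odot>\<^bsub>V\<^esub> x)"
      by (auto simp: a_r_coset_def')
    then show ?thesis using mV.a_repr_independence' a x by simp
  qed
  have "(\<mm> +> a) \<odot>\<^bsub>reduced_module R \<mm> V\<^esub> \<pi> x = (\<Union>b\<in>\<mm> +> a. \<Union>y\<in>\<pi> x. \<pi> (b \<odot>\<^bsub>V\<^esub> y))"
    by (simp add: reduced_module_def Let_def)
  also have "\<dots> = (\<Union>b\<in>\<mm> +> a. \<Union>y\<in>\<pi> x. \<pi> (a \<odot>\<^bsub>V\<^esub> x))"
    by (intro SUP_cong refl indep)
  also have "\<dots> = \<pi> (a \<odot>\<^bsub>V\<^esub> x)"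
  proof -
    have "\<mm> +> a \<noteq> {}" "\<pi> x \<noteq> {}"
      using a_rcos_self[OF a] mV.a_rcos_self[OF x] by blast+
    then show ?thesis by simp
  qed
  finally show ?thesis .
qed

lemma semilinear_image_reduced:
  "semilinear_image R V (R Quot \<mm>) (reduced_module R \<mm> V) ((+>) \<mm>) \<pi>"
proof -
  interpret mV: abelian_subgroup mV V
    by (rule submodule_abelian_subgroup[OF submodule_mV])
  show ?thesis
  proof (intro semilinear_image.intro semilinear_image_axioms.intro)
    show "module R V" by (rule module_axioms)
    show "cring (R Quot \<mm>)" by (rule quotient_is_cring[OF is_cring])
    show "(+>) \<mm> \<in> ring_hom R (R Quot \<mm>)" by (rule rcos_ring_hom)
    show "carrier (R Quot \<mm>) = (+>) \<mm> ` carrier R"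
      by (auto simp: FactRing_def A_RCOSETS_def')
    show "carrier (reduced_module R \<mm> V) = \<pi> ` carrier V" by (rule carrier_reduced_module)
    show "\<pi> \<zero>\<^bsub>V\<^esub> = \<zero>\<^bsub>reduced_module R \<mm> V\<^esub>"
      using mV.a_rcos_const[OF submodule.zero_closed[OF submodule_mV]]
      by (simp add: reduced_module_def Let_def)
    show "\<pi> (x \<oplus>\<^bsub>V\<^esub> y) = \<pi> x \<oplus>\<^bsub>reduced_module R \<mm> V\<^esub> \<pi> y"
      if "x \<in> carrier V" "y \<in> carrier V" for x y
      using mV.a_rcos_sum[OF that] by (simp add: reduced_module_def Let_def)
    show "\<pi> (a \<odot>\<^bsub>V\<^esub> x) = (\<mm> +> a) \<odot>\<^bsub>reduced_module R \<mm> V\<^esub> \<pi> x"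
      if "a \<in> carrier R" "x \<in> carrier V" for a x
      using smult_reduced_module[OF that] by simp
  qed
qed

text \<open>From left to right, lifted generators of the vector space span \<open>V\<close> up to
  \<open>mV\<close>, and Nakayama's lemma removes the error. Conversely, generators of
  \<open>V\<close> map to generators of the quotient.\<close>

lemma mu_le_iff:
  assumes fg: "fg_module R V"
  shows "mu R \<mm> V \<le> n \<longleftrightarrow> generated_by_at_most R V n"
proof -
  interpret mV: abelian_subgroup mV V
    by (rule submodule_abelian_subgroup[OF submodule_mV])
  interpret red: semilinear_image R V "R Quot \<mm>" "reduced_module R \<mm> V" "(+>) \<mm>" \<pi>
    by (rule semilinear_image_reduced)
  interpret Q: vectorspace "R Quot \<mm>" "reduced_module R \<mm> V"
    by (intro vectorspace.intro red.module_image quotient_is_field is_cring)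
  obtain T where T: "finite T" "T \<subseteq> carrier V" "span T = carrier V"
    using fg unfolding fg_module_def by blast
  have gen: "Q.span (\<pi> ` S) = carrier (reduced_module R \<mm> V)"
    if "S \<subseteq> carrier V" "span S = carrier V" for S
    using red.span_image[OF that(1)] that(2) red.f_surj by simp
  have sub: "\<pi> ` S \<subseteq> carrier (reduced_module R \<mm> V)" if "S \<subseteq> carrier V" for S
    using that red.f_surj by auto
  show ?thesis
  proof
    assume le: "mu R \<mm> V \<le> n"
    \<comment> \<open>\<open>dim\<close> is the least size of a finite generating set; the image of
      \<open>T\<close> shows that such sets exist, so the least size is attained.\<close>
    have "\<exists>A. finite A \<and> card A = Q.dim \<and> A \<subseteq> carrier (reduced_module R \<mm> V) \<and> Q.gen_set A"
      unfolding Q.dim_def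
      by (rule LeastI_ex) (use T gen[OF T(2,3)] sub[OF T(2)] in blast)
    then obtain A where A: "finite A" "card A = Q.dim" "A \<subseteq> \<pi> ` carrier V" "Q.gen_set A"
      using red.f_surj by auto
    \<comment> \<open>One preimage is chosen per element of \<open>A\<close>, so lifting does not
      change the number of generators.\<close>
    obtain W where W0: "W \<subseteq> carrier V" "inj_on \<pi> W" "A = \<pi> ` W"
      using A(3) unfolding subset_image_inj by blast
    have W: "W \<subseteq> carrier V" "finite W" "A = \<pi> ` W" "card W = card A"
      using W0 A(1) by (simp_all add: finite_image_iff card_image)
    have "span W = carrier V"
    proof (rule nakayama[OF T(1,2) W(1)])
      show "span (W \<union> T) = carrier V"
        using T span_is_monotone[of T "W \<union> T"] span_is_subset2[of "W \<union> T"] W(1) by blast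
      fix x assume x: "x \<in> carrier V"
      have "\<pi> x \<in> \<pi> ` span W"
        using A(4) red.span_image[OF W(1)] W(3) red.f_surj x by auto
      then obtain w where w: "w \<in> span W" "\<pi> x = \<pi> w" by blast
      then have "x \<in> \<pi> w" using mV.a_rcos_self[OF x] by simp
      then show "\<exists>w\<in>span W. \<exists>n\<in>mV. x = n \<oplus>\<^bsub>V\<^esub> w"
        using w(1) by (auto simp: a_r_coset_def')
    qed
    then show "generated_by_at_most R V n"
      using W A(2) le by (intro generated_by_at_mostI[of W]) (auto simp: mu_def)
  next
    assume "generated_by_at_most R V n"
    then obtain S where S: "finite S" "card S \<le> n" "S \<subseteq> carrier V" "span S = carrier V"
      by (rule generated_by_at_mostE)
    have "Q.dim \<le> card (\<pi> ` S)"
      unfolding Q.dim_def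
      by (rule Least_le) (use S gen[OF S(3,4)] sub[OF S(3)] in blast)
    also have "\<dots> \<le> n" using card_image_le[OF S(1), of \<pi>] S(2) by simp
    finally show "mu R \<mm> V \<le> n" by (simp add: mu_def)
  qed
qed

end

section \<open>Submodules over chain rings\<close>

lemma chain_ring_dvd_total:
  fixes R (structure)
  assumes "chain_ring R" and "a \<in> carrier R" and "b \<in> carrier R"
  shows "(\<exists>c\<in>carrier R. a = c \<otimes> b) \<or> (\<exists>c\<in>carrier R. b = c \<otimes> a)"
proof -
  interpret cring R using assms(1) by (simp add: chain_ring_def)
  have "PIdl a \<subseteq> PIdl b \<or> PIdl b \<subseteq> PIdl a"
    using assms cgenideal_ideal by (auto simp: chain_ring_def)
  then have "a \<in> PIdl b \<or> b \<in> PIdl a" using assms(2,3) cgenideal_self by blast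
  then show ?thesis by (auto simp: cgenideal_def)
qed

text \<open>Stated for a family indexed by \<open>T\<close> because it serves coefficients of module
  elements: these may coincide, and the pivot must be one of the elements. By transitivity a new
  coefficient only needs comparison with the old pivot.\<close>

lemma chain_ring_finite_dvd_all:
  fixes R (structure)
  assumes R: "chain_ring R" and "finite T" "T \<noteq> {}" "a \<in> T \<rightarrow> carrier R"
  shows "\<exists>t\<in>T. \<forall>s\<in>T. \<exists>c\<in>carrier R. a s = c \<otimes> a t"
  using assms(2-)
proof (induction T rule: finite_ne_induct)
  case (singleton x)
  interpret cring R using R by (simp add: chain_ring_def)
  have "a x = \<one> \<otimes> a x" using singleton by simp
  then show ?case by blast
next
  case (insert x T)
  interpret cring R using R by (simp add: chain_ring_def)
  have ax: "a x \<in> carrier R" using insert.prems by auto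
  obtain t where t: "t \<in> T" "\<And>s. s \<in> T \<Longrightarrow> \<exists>c\<in>carrier R. a s = c \<otimes> a t"
    using insert by auto
  have at: "a t \<in> carrier R" using t insert.prems by auto
  from chain_ring_dvd_total[OF R ax at] show ?case
  proof
    assume "\<exists>c\<in>carrier R. a x = c \<otimes> a t"
    then show ?thesis using t by blast
  next
    assume "\<exists>c\<in>carrier R. a t = c \<otimes> a x"
    then obtain c where c: "c \<in> carrier R" "a t = c \<otimes> a x" by blast
    have "\<exists>d\<in>carrier R. a s = d \<otimes> a x" if s: "s \<in> T" for s
    proof -
      obtain d where "d \<in> carrier R" "a s = d \<otimes> a t" using t(2)[OF s] by blast
      then have "a s = (d \<otimes> c) \<otimes> a x" "d \<otimes> c \<in> carrier R"
        using c ax by (simp_all add: m_assoc)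
      then show ?thesis by blast
    qed
    moreover have "a x = \<one> \<otimes> a x" using ax by simp
    ultimately show ?thesis by blast
  qed
qed

text \<open>Gaussian elimination: among the coefficients of a fixed generator one divides all others, so
  a single element of \<open>T\<close> clears that generator from the remaining ones.\<close>

lemma (in module) chain_ring_span_subset:
  assumes R: "chain_ring R" and "finite S" "S \<subseteq> carrier M" "finite T" "T \<subseteq> span S"
  shows "\<exists>T'. finite T' \<and> card T' \<le> card S \<and> T' \<subseteq> carrier M \<and> span T' = span T"
  using assms(2-)
proof (induction S arbitrary: T rule: finite_induct)
  case empty
  have "T \<subseteq> {\<zero>\<^bsub>M\<^esub>}" using empty by (auto simp: span_def lincomb_def)
  moreover have "submodule R {\<zero>\<^bsub>M\<^esub>} M"
    by (intro submodule.intro) (auto simp: module_axioms)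
  ultimately have "span T \<subseteq> {\<zero>\<^bsub>M\<^esub>}" by (rule span_is_subset)
  moreover have "\<zero>\<^bsub>M\<^esub> \<in> span T"
    using \<open>T \<subseteq> {\<zero>\<^bsub>M\<^esub>}\<close> by (intro submodule.zero_closed[OF span_is_submodule]) auto
  moreover have "span {} = {\<zero>\<^bsub>M\<^esub>}" by (auto simp: span_def lincomb_def)
  ultimately have "span {} = span T" by auto
  then show ?case by (intro exI[of _ "{}"]) simp
next
  case (insert s S)
  have s: "s \<in> carrier M" and S: "S \<subseteq> carrier M" using insert.prems by auto
  note subS = span_is_submodule[OF S]
  have TM: "T \<subseteq> carrier M"
    using insert.prems(3) span_is_subset2[OF insert.prems(1)] by blast
  show ?case
  proof (cases "T = {}")
    case True
    then show ?thesis by (intro exI[of _ "{}"]) simp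
  next
    case False
    have "\<forall>t\<in>T. \<exists>a y. a \<in> carrier R \<and> y \<in> span S \<and> t = a \<odot>\<^bsub>M\<^esub> s \<oplus>\<^bsub>M\<^esub> y"
      using insert.prems(3) span_insert[OF s S] by blast
    then obtain a y where aR: "\<And>t. t \<in> T \<Longrightarrow> a t \<in> carrier R"
        and yS: "\<And>t. t \<in> T \<Longrightarrow> y t \<in> span S"
        and t_eq: "\<And>t. t \<in> T \<Longrightarrow> a t \<odot>\<^bsub>M\<^esub> s \<oplus>\<^bsub>M\<^esub> y t = t"
      by metis
    have yM: "y t \<in> carrier M" if "t \<in> T" for t
      using yS[OF that] submodule.subset[OF subS] by blast
    obtain t0 where t0: "t0 \<in> T" "\<forall>t\<in>T. \<exists>c\<in>carrier R. a t = c \<otimes> a t0"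
      using chain_ring_finite_dvd_all[OF R insert.prems(2) False, of a] aR by auto
    then obtain c where cR: "\<And>t. t \<in> T \<Longrightarrow> c t \<in> carrier R"
        and a_eq: "\<And>t. t \<in> T \<Longrightarrow> a t = c t \<otimes> a t0"
      by metis
    have t0M: "t0 \<in> carrier M" using t0 TM by blast
    \<comment> \<open>Subtracting \<open>c t\<close> times the pivot cancels the coefficient of
      \<open>s\<close>. As \<open>c t0\<close> need not be \<open>\<one>\<close>,
      \<open>g t0\<close> need not vanish; it lies in \<open>span S\<close> like the others, so
      \<open>t0\<close> gets no separate treatment.\<close>
    define g where "g t = t \<ominus>\<^bsub>M\<^esub> c t \<odot>\<^bsub>M\<^esub> t0" for t
    have gM: "g ` T \<subseteq> carrier M" using TM cR t0M by (auto simp: g_def)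
    have "g t \<in> span S" if t: "t \<in> T" for t
    proof -
      have carr: "a t0 \<in> carrier R" "c t \<in> carrier R" "y t \<in> carrier M" "y t0 \<in> carrier M"
        using t t0 aR cR yM by auto
      have "c t \<odot>\<^bsub>M\<^esub> (a t0 \<odot>\<^bsub>M\<^esub> s \<oplus>\<^bsub>M\<^esub> y t0) = a t \<odot>\<^bsub>M\<^esub> s \<oplus>\<^bsub>M\<^esub> c t \<odot>\<^bsub>M\<^esub> y t0"
        using carr s a_eq[OF t] by (simp add: smult_r_distr smult_assoc1)
      then have "g t = (a t \<odot>\<^bsub>M\<^esub> s \<oplus>\<^bsub>M\<^esub> y t) \<ominus>\<^bsub>M\<^esub> (a t \<odot>\<^bsub>M\<^esub> s \<oplus>\<^bsub>M\<^esub> c t \<odot>\<^bsub>M\<^esub> y t0)"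
        using t_eq[OF t] t_eq[OF t0(1)] by (simp add: g_def)
      also have "\<dots> = y t \<oplus>\<^bsub>M\<^esub> \<ominus>\<^bsub>M\<^esub> (c t \<odot>\<^bsub>M\<^esub> y t0)"
        using carr s aR[OF t] by (simp add: M.minus_eq M.minus_add M.a_ac M.r_neg1 M.r_neg2)
      finally show ?thesis
        using yS[OF t] yS[OF t0(1)] carr submodule.m_closed[OF subS]
          submodule.smult_closed[OF subS] submodule_a_inv[OF subS] by simp
    qed
    \<comment> \<open>The induction keeps \<open>T\<close> arbitrary, so it applies to the
      remainders. They cost \<open>card S\<close> generators, and the pivot \<open>t0\<close> uses
      the one more that \<open>s\<close> allows.\<close>
    then obtain T1 where T1: "finite T1" "card T1 \<le> card S" "T1 \<subseteq> carrier M"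
        "span T1 = span (g ` T)"
      using insert.IH[of "g ` T"] S insert.prems(2) by auto
    have ins: "insert t0 T1 \<subseteq> carrier M" "insert t0 (g ` T) \<subseteq> carrier M" using T1 t0M gM by auto
    have "span (insert t0 T1) = span (insert t0 (g ` T))"
      using span_insert[OF t0M T1(3)] span_insert[OF t0M gM] T1(4) by simp
    also have "\<dots> = span T"
    proof
      have subT: "submodule R (span T) M" by (rule span_is_submodule[OF TM])
      have own: "T \<subseteq> span T" by (rule in_own_span[OF TM])
      have "g t \<in> span T" if "t \<in> T" for t
        unfolding g_def M.minus_eq
        using own that t0(1) cR[OF that]
        by (intro submodule.m_closed[OF subT] submodule_a_inv[OF subT]
            submodule.smult_closed[OF subT]) auto
      then show "span (insert t0 (g ` T)) \<subseteq> span T"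
        using own t0(1) TM by (intro span_mono_in_span) auto
      have "t \<in> span (insert t0 (g ` T))" if t: "t \<in> T" for t
      proof -
        have tM: "t \<in> carrier M" and cM: "c t \<odot>\<^bsub>M\<^esub> t0 \<in> carrier M" using t TM cR t0M by auto
        have "c t \<odot>\<^bsub>M\<^esub> t0 \<oplus>\<^bsub>M\<^esub> g t = t"
          using tM cM by (simp add: g_def M.minus_eq M.a_ac M.r_neg)
        moreover have "g t \<in> span (g ` T)" using in_own_span[OF gM] t by blast
        ultimately show ?thesis unfolding span_insert[OF t0M gM] using cR[OF t] by force
      qed
      then show "span T \<subseteq> span (insert t0 (g ` T))"
        using ins by (intro span_mono_in_span) auto
    qed
    finally have "span (insert t0 T1) = span T" .
    moreover have "card (insert t0 T1) \<le> card (insert s S)"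
      using T1 insert.hyps by (simp add: card_insert_if)
    ultimately show ?thesis using T1(1) ins(1) by blast
  qed
qed

text \<open>Elimination starts from a generating set of \<open>V\<close> with at most
  \<open>mu R \<mm> V\<close> elements. It takes place inside \<open>V\<close>, which is why the
  type \<open>'b\<close> can be left arbitrary.\<close>

lemma chain_ring_imp_mu_mono_modules:
  assumes local: "local_ring R \<mm>" and chain: "chain_ring R"
  shows "mu_mono_modules TYPE('b) R \<mm>"
  unfolding mu_mono_modules_def
proof (intro allI impI)
  fix V :: "('a, 'b) module" and V'
  assume V: "fg_module R V" and sub: "submodule R V' V" and V': "fg_module R (V\<lparr>carrier := V'\<rparr>)"
  let ?V' = "V\<lparr>carrier := V'\<rparr>"
  interpret V: module R V using V by (simp add: fg_module_def)
  interpret V': module R ?V' using V' by (simp add: fg_module_def)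
  interpret local_ring R \<mm> by (rule local)
  interpret LV: local_ring_module R \<mm> V by unfold_locales
  interpret LV': local_ring_module R \<mm> ?V' by unfold_locales
  obtain S where S: "finite S" "card S \<le> mu R \<mm> V" "S \<subseteq> carrier V" "V.span S = carrier V"
    using LV.mu_le_iff[OF V, of "mu R \<mm> V"] generated_by_at_mostE by blast
  obtain T where T: "finite T" "T \<subseteq> V'" "V'.span T = V'"
    using V' by (auto simp: fg_module_def)
  have T_span: "V.span T = V'" using V.span_li_not_depend(1)[OF T(2) sub] T(3) by simp
  obtain T' where T': "finite T'" "card T' \<le> card S" "T' \<subseteq> carrier V" "V.span T' = V.span T"
    using V.chain_ring_span_subset[OF chain S(1,3) T(1)] S(4) T(2) submodule.subset[OF sub] by auto
  \<comment> \<open>Elimination only places \<open>T'\<close> in \<open>carrier V\<close>; the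
    equality of spans moves it into \<open>V'\<close>.\<close>
  have "T' \<subseteq> V'" using V.in_own_span[OF T'(3)] T'(4) T_span by blast
  moreover from this have "V'.span T' = V'"
    using V.span_li_not_depend(1)[OF _ sub] T'(4) T_span by simp
  ultimately have "generated_by_at_most R ?V' (mu R \<mm> V)"
    using T' S(2) by (intro generated_by_at_mostI[of T']) auto
  then show "mu R \<mm> ?V' \<le> mu R \<mm> V" using LV'.mu_le_iff[OF V'] by simp
qed

section \<open>Ideals as modules\<close>

lemma carrier_ideal_module [simp]: "carrier (ideal_module R I) = I"
  by (simp add: ideal_module_def)

lemma ideal_module_update_carrier: "(ideal_module R I)\<lparr>carrier := J\<rparr> = ideal_module R J"
  by (simp add: ideal_module_def)

context cring
begin

lemma module_ideal_module:
  assumes "ideal I R"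
  shows "module R (ideal_module R I)"
proof -
  interpret I: ideal I R by (rule assms)
  have "\<exists>w\<in>I. v \<oplus> w = \<zero>" if "v \<in> I" for v
    using that I.a_inv_closed[OF that] I.Icarr[OF that] r_neg[of v] by blast
  then show ?thesis
    by (intro module_criteria)
      (auto simp: ideal_module_def is_cring I.Icarr I.I_l_closed a_ac m_assoc l_distr r_distr)
qed

lemma submodule_ideal_module_iff:
  assumes "ideal I R"
  shows "submodule R J (ideal_module R I) \<longleftrightarrow> ideal J R \<and> J \<subseteq> I"
proof
  interpret I: ideal I R by (rule assms)
  assume sub: "submodule R J (ideal_module R I)"
  then have JI: "J \<subseteq> I" using submodule.subset by fastforce
  then have J: "J \<subseteq> carrier R" using I.Icarr by blast
  have smult: "a \<otimes> x \<in> J" if "a \<in> carrier R" "x \<in> J" for a x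
    using submodule.smult_closed[OF sub that] by (simp add: ideal_module_def)
  have "ideal J R"
  proof (rule idealI)
    show "ring R" by (rule ring_axioms)
    show "subgroup J (add_monoid R)"
    proof (rule add.subgroupI)
      show "J \<subseteq> carrier R" by (rule J)
      show "J \<noteq> {}" using submodule.zero_closed[OF sub] by blast
      show "x \<oplus> y \<in> J" if "x \<in> J" "y \<in> J" for x y
        using submodule.m_closed[OF sub that] by (simp add: ideal_module_def)
      show "\<ominus> x \<in> J" if "x \<in> J" for x
      proof -
        have "\<ominus> x = (\<ominus> \<one>) \<otimes> x" using that J by (simp add: l_minus subsetD)
        then show ?thesis using smult[of "\<ominus> \<one>" x] that by simp
      qed
    qed
    show "x \<otimes> a \<in> J" if "a \<in> J" "x \<in> carrier R" for a x using smult that by blast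
    show "a \<otimes> x \<in> J" if "a \<in> J" "x \<in> carrier R" for a x
      using smult[of x a] that J m_comm[of x a] by auto
  qed
  then show "ideal J R \<and> J \<subseteq> I"
    using JI by simp
next
  assume J: "ideal J R \<and> J \<subseteq> I"
  then interpret J: ideal J R by simp
  show "submodule R J (ideal_module R I)"
    by (rule submodule.intro[OF module_ideal_module[OF assms]])
      (use J in \<open>auto simp: ideal_module_def J.I_l_closed\<close>)
qed

lemma submodule_carrier_iff: "submodule R J (ideal_module R (carrier R)) \<longleftrightarrow> ideal J R"
  by (auto simp: submodule_ideal_module_iff[OF oneideal] dest: ideal.Icarr)

text \<open>A span does not change when computed in the larger module \<open>R\<close>, whose
  submodules are exactly the ideals; there the span and the generated ideal satisfy the same
  minimality.\<close>

lemma span_ideal_module: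
  assumes I: "ideal I R" and S: "S \<subseteq> I"
  shows "module.span R (ideal_module R I) S = Idl S"
proof -
  interpret RR: module R "ideal_module R (carrier R)" by (rule module_ideal_module[OF oneideal])
  have SR: "S \<subseteq> carrier R" using S ideal.Icarr[OF I] by blast
  have "module.span R (ideal_module R I) S = RR.span S"
    using RR.span_li_not_depend(1)[OF S] I
    by (simp add: submodule_carrier_iff ideal_module_update_carrier)
  also have "\<dots> = Idl S"
  proof
    show "RR.span S \<subseteq> Idl S"
      using SR genideal_self[OF SR]
      by (intro RR.span_is_subset) (auto simp: submodule_carrier_iff genideal_ideal)
    show "Idl S \<subseteq> RR.span S"
      using SR RR.span_is_submodule[of S] RR.in_own_span[of S]
      by (intro genideal_minimal) (auto simp: submodule_carrier_iff)
  qed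
  finally show ?thesis .
qed

lemma fg_ideal_imp_ideal:
  assumes "fg_ideal R I"
  shows "ideal I R"
  using assms genideal_ideal by (auto simp: fg_ideal_def)

lemma fg_ideal_imp_fg_module:
  assumes "fg_ideal R I"
  shows "fg_module R (ideal_module R I)"
proof -
  have I: "ideal I R" by (rule fg_ideal_imp_ideal[OF assms])
  obtain S where S: "finite S" "S \<subseteq> carrier R" "I = Idl S"
    using assms by (auto simp: fg_ideal_def)
  then have "S \<subseteq> I" using genideal_self by blast
  then show ?thesis
    using S I span_ideal_module[OF I] module_ideal_module[OF I] by (auto simp: fg_module_def)
qed

lemma generated_by_at_most_ideal_module_iff:
  assumes "ideal I R"
  shows "generated_by_at_most R (ideal_module R I) n \<longleftrightarrow>
    (\<exists>S. finite S \<and> card S \<le> n \<and> S \<subseteq> I \<and> Idl S = I)"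
  using span_ideal_module[OF assms] by (auto simp: generated_by_at_most_def)

section \<open>From monotonicity on ideals to the chain condition\<close>

lemma in_genideal_pair:
  assumes a: "a \<in> carrier R" and b: "b \<in> carrier R" and c: "c \<in> Idl {a, b}"
  shows "\<exists>x\<in>carrier R. \<exists>y\<in>carrier R. c = x \<otimes> a \<oplus> y \<otimes> b"
proof -
  interpret RR: module R "ideal_module R (carrier R)" by (rule module_ideal_module[OF oneideal])
  have "c \<in> RR.span {a, b}" using c a b span_ideal_module[OF oneideal, of "{a, b}"] by simp
  then obtain x z where x: "x \<in> carrier R" "z \<in> RR.span {b}" "c = x \<otimes> a \<oplus> z"
    using RR.span_insert[of a "{b}"] a b by (auto simp: ideal_module_def)
  have "z \<in> PIdl b"
    using x(2) b span_ideal_module[OF oneideal, of "{b}"] cgenideal_eq_genideal[OF b] by simp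
  then show ?thesis using x by (auto simp: cgenideal_def)
qed

end

text \<open>By hypothesis \<open>(a, b) = (c)\<close>, say \<open>a = a' c\<close> and \<open>b = b' c\<close>. If \<open>a'\<close> and \<open>b'\<close> both lie in \<open>\<mm>\<close>,
  then \<open>c = d c\<close> with \<open>d \<in> \<mm>\<close>, whence \<open>c = 0\<close>; otherwise \<open>a\<close> or \<open>b\<close> generates \<open>(c)\<close>.\<close>

lemma (in local_ring) mu_mono_ideals_imp_dvd_total:
  assumes mono: "mu_mono_ideals R \<mm>" and a: "a \<in> carrier R" and b: "b \<in> carrier R"
  shows "a \<in> PIdl b \<or> b \<in> PIdl a"
proof -
  have fg: "fg_ideal R (Idl {a, b})" "fg_ideal R (Idl {\<one>})"
    unfolding fg_ideal_def using a b
    by (metis finite.emptyI finite_insert empty_subsetI insert_subset one_closed)+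
  note ideals = fg[THEN fg_ideal_imp_ideal]
  interpret I: local_ring_module R \<mm> "ideal_module R (Idl {a, b})"
    by (intro local_ring_module.intro local_ring_axioms module_ideal_module ideals)
  interpret J: local_ring_module R \<mm> "ideal_module R (Idl {\<one>})"
    by (intro local_ring_module.intro local_ring_axioms module_ideal_module ideals)
  have "generated_by_at_most R (ideal_module R (Idl {\<one>})) 1"
    unfolding generated_by_at_most_ideal_module_iff[OF ideals(2)]
    by (rule exI[of _ "{\<one>}"]) (auto simp: genideal_self')
  then have "mu R \<mm> (ideal_module R (Idl {\<one>})) \<le> 1"
    using J.mu_le_iff[OF fg_ideal_imp_fg_module[OF fg(2)]] by simp
  moreover have "mu R \<mm> (ideal_module R (Idl {a, b})) \<le> mu R \<mm> (ideal_module R (Idl {\<one>}))"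
    using mono fg ideal.Icarr[OF ideals(1)] genideal_one by (auto simp: mu_mono_ideals_def)
  ultimately have "generated_by_at_most R (ideal_module R (Idl {a, b})) 1"
    using I.mu_le_iff[OF fg_ideal_imp_fg_module[OF fg(1)], of 1] by simp
  then obtain S where S: "finite S" "card S \<le> 1" "S \<subseteq> Idl {a, b}" "Idl S = Idl {a, b}"
    unfolding generated_by_at_most_ideal_module_iff[OF ideals(1)] by blast
  \<comment> \<open>A set with at most one element may be empty; the ideal is then zero and
    \<open>\<zero>\<close> serves as its generator.\<close>
  obtain c where c: "S \<subseteq> {c}" "c \<in> Idl {a, b}"
  proof (cases "S = {}")
    case True
    then show ?thesis
      using that[of \<zero>] additive_subgroup.zero_closed[OF ideal.axioms(1)[OF ideals(1)]] by simp
  next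
    case False
    then have "card S = 1" using S(1,2) by (simp add: le_Suc_eq)
    then show ?thesis using that S(3) by (auto simp: card_1_singleton_iff)
  qed
  have cR: "c \<in> carrier R" using c(2) ideal.Icarr[OF ideals(1)] by blast
  have "Idl {a, b} \<subseteq> PIdl c"
    unfolding S(4)[symmetric] using c(1) cgenideal_self[OF cR]
    by (intro genideal_minimal cgenideal_ideal cR) auto
  moreover have "a \<in> Idl {a, b}" "b \<in> Idl {a, b}" using genideal_self[of "{a, b}"] a b by auto
  ultimately have "a \<in> PIdl c" "b \<in> PIdl c" by blast+
  then obtain a' b' where a': "a' \<in> carrier R" "a = a' \<otimes> c"
    and b': "b' \<in> carrier R" "b = b' \<otimes> c"
    by (auto simp: cgenideal_def)
  obtain x y where xy: "x \<in> carrier R" "y \<in> carrier R" "c = x \<otimes> a \<oplus> y \<otimes> b"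
    using in_genideal_pair[OF a b c(2)] by blast
  \<comment> \<open>Stated for a generic pair so that it applies to \<open>a\<close> and
    \<open>b\<close> in either order: \<open>u'\<close> outside \<open>\<mm>\<close> is invertible,
    so \<open>u\<close> generates the same ideal as \<open>c\<close>.\<close>
  have cases: "v \<in> PIdl u"
    if u: "u' \<in> carrier R" "u = u' \<otimes> c" "u' \<notin> \<mm>" and v: "v' \<in> carrier R" "v = v' \<otimes> c"
    for u u' v v'
  proof -
    have unit: "u' \<in> Units R" using Units_if_notin_maximal u by blast
    have "v = v' \<otimes> ((inv u' \<otimes> u') \<otimes> c)" using unit v cR by simp
    also have "\<dots> = (v' \<otimes> inv u') \<otimes> u"
      using unit u v cR by (simp add: m_assoc del: Units_l_inv)
    finally show ?thesis using unit v by (auto simp: cgenideal_def)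
  qed
  show ?thesis
  proof (cases "a' \<in> \<mm> \<and> b' \<in> \<mm>")
    case False
    then show ?thesis using cases[OF a' _ b'] cases[OF b' _ a'] by blast
  next
    case True
    define d where "d = x \<otimes> a' \<oplus> y \<otimes> b'"
    have d: "d \<in> \<mm>"
      unfolding d_def using True xy by (intro a_closed I_l_closed) auto
    then have dR: "d \<in> carrier R" using Icarr by blast
    have "c = d \<otimes> c"
      using xy(1,2) a' b' cR by (subst xy(3)) (simp add: d_def l_distr m_assoc)
    then have dc: "d \<otimes> c = c" by simp
    have "(\<one> \<ominus> d) \<otimes> c = \<zero>"
      using dR cR dc by (simp add: a_minus_def l_distr l_minus r_neg)
    then have "c = \<zero>"
      using Units_l_cancel[OF Units_one_minus[OF d] cR, of \<zero>] dR by simp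
    then have "a = \<zero>" using a' by simp
    then show ?thesis
      using additive_subgroup.zero_closed[OF ideal.axioms(1)[OF cgenideal_ideal[OF b]]] by simp
  qed
qed

text \<open>Arbitrary ideals reduce to principal ones: incomparable \<open>I\<close> and
  \<open>J\<close> would contain elements \<open>a\<close> and \<open>b\<close> neither of which
  divides the other.\<close>

lemma (in local_ring) mu_mono_ideals_imp_chain_ring:
  assumes "mu_mono_ideals R \<mm>"
  shows "chain_ring R"
  unfolding chain_ring_def
proof (intro conjI allI impI is_cring)
  fix I J assume I: "ideal I R" and J: "ideal J R"
  show "I \<subseteq> J \<or> J \<subseteq> I"
  proof (rule ccontr)
    assume "\<not> (I \<subseteq> J \<or> J \<subseteq> I)"
    then obtain a b where ab: "a \<in> I" "a \<notin> J" "b \<in> J" "b \<notin> I" by blast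
    have "PIdl a \<subseteq> I" "PIdl b \<subseteq> J" using cgenideal_minimal I J ab by auto
    then show False
      using mu_mono_ideals_imp_dvd_total[OF assms, of a b] ab ideal.Icarr[OF I] ideal.Icarr[OF J]
      by blast
  qed
qed

section \<open>Transport of structure\<close>

text \<open>Elements are pulled back by \<open>the_inv f\<close>, combined in \<open>M\<close> and
  pushed forward again; injectivity of \<open>f\<close> on the whole type makes the inverse
  unambiguous.\<close>

definition transport_module :: "('b \<Rightarrow> 'c) \<Rightarrow> ('a, 'b, 's) module_scheme \<Rightarrow> ('a, 'c) module" where
  "transport_module f M =
     \<lparr>carrier = f ` carrier M, mult = (\<lambda>_ _. f \<zero>\<^bsub>M\<^esub>), one = f \<zero>\<^bsub>M\<^esub>, zero = f \<zero>\<^bsub>M\<^esub>,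
      add = (\<lambda>x y. f (the_inv f x \<oplus>\<^bsub>M\<^esub> the_inv f y)),
      smult = (\<lambda>a x. f (a \<odot>\<^bsub>M\<^esub> the_inv f x))\<rparr>"

lemma transport_module_update_carrier:
  "(transport_module f M)\<lparr>carrier := f ` P\<rparr> = transport_module f (M\<lparr>carrier := P\<rparr>)"
  by (simp add: transport_module_def)

lemma (in module) semilinear_image_transport:
  assumes "inj f"
  shows "semilinear_image R M R (transport_module f M) id f"
  by unfold_locales (auto simp: ring_hom_def transport_module_def the_inv_f_f[OF assms])

lemma (in module) generated_by_at_most_transport_iff:
  assumes "inj f"
  shows "generated_by_at_most R (transport_module f M) n \<longleftrightarrow> generated_by_at_most R M n"
proof -
  interpret tr: semilinear_image R M R "transport_module f M" id f
    by (rule semilinear_image_transport[OF assms])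
  show ?thesis
  proof
    assume "generated_by_at_most R (transport_module f M) n"
    then obtain B where B: "finite B" "card B \<le> n" "B \<subseteq> carrier (transport_module f M)"
        "module.span R (transport_module f M) B = carrier (transport_module f M)"
      by (rule generated_by_at_mostE)
    then obtain S where S: "S \<subseteq> carrier M" "B = f ` S"
      unfolding tr.f_surj subset_image_iff by blast
    have "f ` span S = f ` carrier M" using B(4) tr.span_image[OF S(1)] S(2) tr.f_surj by simp
    then have "span S = carrier M" by (simp add: inj_image_eq_iff[OF assms])
    moreover have "inj_on f S" using assms inj_on_subset by blast
    ultimately show "generated_by_at_most R M n"
      using B(1,2) S by (intro generated_by_at_mostI[of S]) (auto simp: finite_image_iff card_image)
  next
    assume "generated_by_at_most R M n"
    then obtain S where S: "finite S" "card S \<le> n" "S \<subseteq> carrier M" "span S = carrier M"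
      by (rule generated_by_at_mostE)
    then show "generated_by_at_most R (transport_module f M) n"
      using tr.span_image[OF S(3)] tr.f_surj card_image_le[OF S(1), of f]
      by (intro generated_by_at_mostI[of "f ` S"]) auto
  qed
qed

lemma fg_module_iff_generated_by_at_most:
  "fg_module R V \<longleftrightarrow> module R V \<and> (\<exists>n. generated_by_at_most R V n)"
  unfolding fg_module_def generated_by_at_most_def by blast

lemma fg_module_transport:
  assumes "inj f" and "fg_module R M"
  shows "fg_module R (transport_module f M)"
proof -
  interpret module R M using assms(2) by (simp add: fg_module_def)
  interpret tr: semilinear_image R M R "transport_module f M" id f
    by (rule semilinear_image_transport[OF assms(1)])
  show ?thesis
    using assms(2) tr.module_image
    by (simp add: fg_module_iff_generated_by_at_most generated_by_at_most_transport_iff[OF assms(1)])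
qed

text \<open>No isomorphism of the reduced modules is built: generating sets correspond, so both
  sides have the same upper bounds, and these determine a natural number.\<close>

lemma mu_transport:
  assumes "local_ring R \<mm>" and f: "inj f" and fg: "fg_module R M"
  shows "mu R \<mm> (transport_module f M) = mu R \<mm> M"
proof -
  have fg': "fg_module R (transport_module f M)" by (rule fg_module_transport[OF f fg])
  interpret M: module R M using fg by (simp add: fg_module_def)
  interpret LM: local_ring_module R \<mm> M
    using fg assms(1) by (simp add: fg_module_def local_ring_module.intro)
  interpret LT: local_ring_module R \<mm> "transport_module f M"
    using fg' assms(1) by (simp add: fg_module_def local_ring_module.intro)
  have "mu R \<mm> (transport_module f M) \<le> n \<longleftrightarrow> mu R \<mm> M \<le> n" for n
    using LM.mu_le_iff[OF fg] LT.mu_le_iff[OF fg'] M.generated_by_at_most_transport_iff[OF f]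
    by simp
  then show ?thesis by (metis order_antisym order_refl)
qed

text \<open>The inclusion of ideals is copied into the universe of condition (2), compared there,
  and read back through the invariance of \<open>mu\<close> under transport.\<close>

lemma mu_mono_modules_imp_mu_mono_ideals:
  fixes R :: "('a, 'r) ring_scheme"
  assumes local: "local_ring R \<mm>" and mono: "mu_mono_modules TYPE('a fg_universe) R \<mm>"
  shows "mu_mono_ideals R \<mm>"
  unfolding mu_mono_ideals_def
proof (intro allI impI)
  fix I J assume I: "fg_ideal R I" and J: "fg_ideal R J" and JI: "J \<subseteq> I"
  interpret local_ring R \<mm> by (rule local)
  \<comment> \<open>Any injection into the universe would do; a ring element becomes the singleton
    of a constant function.\<close>
  define f :: "'a \<Rightarrow> 'a fg_universe" where "f r = {\<lambda>_. r}" for r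
  have f: "inj f" by (rule injI) (simp add: f_def fun_eq_iff)
  note fgI = fg_ideal_imp_fg_module[OF I]
  note fgJ = fg_ideal_imp_fg_module[OF J]
  let ?V = "transport_module f (ideal_module R I)"
  have V': "?V\<lparr>carrier := f ` J\<rparr> = transport_module f (ideal_module R J)"
    by (simp only: transport_module_update_carrier ideal_module_update_carrier)
  interpret M: module R "ideal_module R I" using fgI by (simp add: fg_module_def)
  interpret tr: semilinear_image R "ideal_module R I" R ?V id f
    by (rule M.semilinear_image_transport[OF f])
  have "submodule R J (ideal_module R I)"
    using submodule_ideal_module_iff[OF fg_ideal_imp_ideal[OF I]] fg_ideal_imp_ideal[OF J] JI by simp
  then have "submodule R (f ` J) ?V" by (rule tr.submodule_image)
  moreover have "fg_module R (?V\<lparr>carrier := f ` J\<rparr>)"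
    unfolding V' by (rule fg_module_transport[OF f fgJ])
  ultimately have "mu R \<mm> (?V\<lparr>carrier := f ` J\<rparr>) \<le> mu R \<mm> ?V"
    using mono fg_module_transport[OF f fgI] unfolding mu_mono_modules_def by blast
  then show "mu R \<mm> (ideal_module R J) \<le> mu R \<mm> (ideal_module R I)"
    unfolding V' by (simp add: mu_transport[OF local f] fgI fgJ)
qed

text \<open>The three implications close a cycle. For the last conjunct, monotonicity on the one
  universe makes \<open>R\<close> a chain ring, and from there monotonicity follows on every type
  \<open>'b\<close>.\<close>

theorem theorem3p8:
  fixes R :: "('a, 'r) ring_scheme" and \<mm> :: "'a set"
  assumes "local_ring R \<mm>"
    and "(\<Inter>l\<in>{1::nat..}. \<mm> [^]\<^bsub>ideals_set R\<^esub> l) = {\<zero>\<^bsub>R\<^esub>}"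
  shows "(chain_ring R \<longleftrightarrow> mu_mono_modules TYPE('a fg_universe) R \<mm>)
    \<and> (mu_mono_modules TYPE('a fg_universe) R \<mm> \<longleftrightarrow> mu_mono_ideals R \<mm>)
    \<and> (mu_mono_modules TYPE('a fg_universe) R \<mm> \<longrightarrow> mu_mono_modules TYPE('b) R \<mm>)"
  using chain_ring_imp_mu_mono_modules[OF assms(1), where 'b = "'a fg_universe"]
    chain_ring_imp_mu_mono_modules[OF assms(1), where 'b = 'b]
    mu_mono_modules_imp_mu_mono_ideals[OF assms(1)]
    local_ring.mu_mono_ideals_imp_chain_ring[OF assms(1)]
  by blast

end
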